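(* Consider the semiparametric model in which $(X,Y,\mathbf{Z})$ has density $$f(x,y,\mathbf{z})=\frac{1}{2\pi\sigma_x\sigma_y\sqrt{1-\rho^2}}\exp\left\{-\frac{1}{2(1-\rho^2)}\left(\frac{\epsilon_x^2}{\sigma_x^2}-2\rho\frac{\epsilon_x\epsilon_y}{\sigma_x\sigma_y}+\frac{\epsilon_y^2}{\sigma_y^2}\right)\right\}f_{\mathbf{Z}}(\mathbf{z}),\qquad \epsilon_x=x-m_x(\mathbf{z}),\ \epsilon_y=y-m_y(\mathbf{z}),$$ with parameter of interest $\rho$ and nuisance parameters $\{\sigma_x,\sigma_y,m_x(\cdot),m_y(\cdot),f_{\mathbf{Z}}(\cdot)\}$. Let $\tilde\epsilon_x=\epsilon_x/\sigma_x$ and $\tilde\epsilon_y=\epsilon_y/\sigma_y$. Then the efficient score for $\rho$ is $$S_{\rm eff}=-\frac{1}{2(1-\rho^2)^2}\left(\rho\tilde\epsilon_x^2-2\tilde\epsilon_x\tilde\epsilon_y+\rho\tilde\epsilon_y^2\right).$$ Furthermore, the semiparametric efficiency bound for estimating $\rho$ is $$\{E(S_{\rm eff}^2)\}^{-1}=(1-\rho^2)^2,$$ and the efficient influence function for $\rho$ is $$\phi_{\rm eff}(x,y,\mathbf{z})=-\frac12\left(\rho\tilde\epsilon_x^2-2\tilde\epsilon_x\tilde\epsilon_y+\rho\tilde\epsilon_y^2\right).$$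
   Context: Gaussian additive noise model (GANM): $X,Y$ are real random variables, $\mathbf{Z}$ is a random vector with density $f_{\mathbf{Z}}$, $X=m_x(\mathbf{Z})+\epsilon_x$, $Y=m_y(\mathbf{Z})+\epsilon_y$, where $(\epsilon_x,\epsilon_y)$ is independent of $\mathbf{Z}$ and bivariate normal with mean zero, variances $\sigma_x^2,\sigma_y^2>0$ and correlation $\rho\in(-1,1)$. The functions $m_x,m_y$ and the density $f_{\mathbf{Z}}$ are otherwise unrestricted. Expectations are under the true distribution. $\mathcal{H}=\{f(x,y,\mathbf{z}): E\{f(X,Y,\mathbf{Z})\}=0,\ \mathrm{var}\{f(X,Y,\mathbf{Z})\}<\infty\}$ is the Hilbert space with inner product $\langle f,g\rangle=E\{f(X,Y,\mathbf{Z})g(X,Y,\mathbf{Z})\}$. The nuisance tangent space is $\Lambda=\Lambda_1+\Lambda_2+\Lambda_3+\Lambda_4+\Lambda_5\subset\mathcal{H}$, where (with $c_1,c_2\in\mathbb{R}$ and $B_1(\mathbf{Z}),B_2(\mathbf{Z}),a(\mathbf{Z})$ ranging over square-integrable functions of $\mathbf{Z}$) $$\Lambda_1=\left\{c_1\left(-\frac{1}{\sigma_x}+\frac{1}{1-\rho^2}\frac{\epsilon_x^2}{\sigma_x^3}-\frac{\rho}{1-\rho^2}\frac{\epsilon_x\epsilon_y}{\sigma_x^2\sigma_y}\right)\right\},\quad \Lambda_2=\left\{c_2\left(-\frac{1}{\sigma_y}+\frac{1}{1-\rho^2}\frac{\epsilon_y^2}{\sigma_y^3}-\frac{\rho}{1-\rho^2}\frac{\epsilon_x\epsilon_y}{\sigma_x\sigma_y^2}\right)\right\},$$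 $$\Lambda_3=\left\{\frac{1}{1-\rho^2}\left(\frac{\epsilon_x}{\sigma_x^2}-\rho\frac{\epsilon_y}{\sigma_x\sigma_y}\right)B_1(\mathbf{z})\right\},\quad \Lambda_4=\left\{\frac{1}{1-\rho^2}\left(\frac{\epsilon_y}{\sigma_y^2}-\rho\frac{\epsilon_x}{\sigma_x\sigma_y}\right)B_2(\mathbf{z})\right\},\quad \Lambda_5=\{a(\mathbf{z}): E\{a(\mathbf{Z})\}=0\}.$$ These are the nuisance tangent spaces for $\sigma_x,\sigma_y,m_x,m_y,f_{\mathbf{Z}}$, respectively. Let $S_\rho=\partial\log f/\partial\rho$ be the score for $\rho$. The efficient score is $S_{\rm eff}=\Pi(S_\rho\mid\Lambda^\perp)$, the orthogonal projection in $\mathcal{H}$ of $S_\rho$ onto the orthogonal complement $\Lambda^\perp$ of $\Lambda$. The semiparametric efficiency bound is $\{E(S_{\rm eff}^2)\}^{-1}$ and the efficient influence function is $\phi_{\rm eff}=\{E(S_{\rm eff}^2)\}^{-1}S_{\rm eff}$. *)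

theory Defs
  imports "HOL-Probability.Probability"
begin

text \<open>
  Throughout, \<open>W\<close> is the observed random vector on the probability space \<open>M\<close>; a function of the
  observation is a Borel function \<open>f\<close> of the values of \<open>W\<close>, and expectations of \<open>f\<close> are
  expectations of \<open>f (W \<omega>)\<close> under \<open>M\<close>. Functions are not identified when they
  agree almost everywhere, so projections are relations, determined up to null sets.
\<close>

definition hilbert_fns :: "'w measure \<Rightarrow> ('w \<Rightarrow> 'b::topological_space) \<Rightarrow> ('b \<Rightarrow> real) set" where
  "hilbert_fns M W = {f \<in> borel_measurable borel.
     integrable M (\<lambda>\<omega>. f (W \<omega>)) \<and> integrable M (\<lambda>\<omega>. (f (W \<omega>))\<^sup>2) \<and>
     (\<integral>\<omega>. f (W \<omega>) \<partial>M) = 0}"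

definition inner_fns :: "'w measure \<Rightarrow> ('w \<Rightarrow> 'b) \<Rightarrow> ('b \<Rightarrow> real) \<Rightarrow> ('b \<Rightarrow> real) \<Rightarrow> real" where
  "inner_fns M W f g = (\<integral>\<omega>. f (W \<omega>) * g (W \<omega>) \<partial>M)"

definition orth_compl ::
  "'w measure \<Rightarrow> ('w \<Rightarrow> 'b::topological_space) \<Rightarrow> ('b \<Rightarrow> real) set \<Rightarrow> ('b \<Rightarrow> real) set" where
  "orth_compl M W V = {h \<in> hilbert_fns M W. \<forall>g\<in>V. inner_fns M W h g = 0}"

definition is_orth_projection ::
  "'w measure \<Rightarrow> ('w \<Rightarrow> 'b::topological_space) \<Rightarrow> ('b \<Rightarrow> real) set \<Rightarrow> ('b \<Rightarrow> real) \<Rightarrow> ('b \<Rightarrow> real) \<Rightarrow> bool"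
where
  "is_orth_projection M W V s p \<longleftrightarrow>
     s \<in> hilbert_fns M W \<and> p \<in> V \<and> (\<lambda>w. s w - p w) \<in> orth_compl M W V"

definition ganm_density ::
  "('z \<Rightarrow> real) \<Rightarrow> ('z \<Rightarrow> real) \<Rightarrow> real \<Rightarrow> real \<Rightarrow> ('z \<Rightarrow> real) \<Rightarrow> real \<Rightarrow> real \<times> real \<times> 'z \<Rightarrow> real" where
  "ganm_density mx my sx sy fZ r = (\<lambda>(x, y, z).
     1 / (2 * pi * sx * sy * sqrt (1 - r\<^sup>2)) *
     exp (- (1 / (2 * (1 - r\<^sup>2))) *
       ((x - mx z)\<^sup>2 / sx\<^sup>2 - 2 * r * ((x - mx z) * (y - my z) / (sx * sy)) + (y - my z)\<^sup>2 / sy\<^sup>2)) *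
     fZ z)"

text \<open>Where \<open>fZ z = 0\<close>, a null set, the convention \<open>ln 0 = 0\<close> makes the score \<open>0\<close>.\<close>

definition score_rho ::
  "('z \<Rightarrow> real) \<Rightarrow> ('z \<Rightarrow> real) \<Rightarrow> real \<Rightarrow> real \<Rightarrow> ('z \<Rightarrow> real) \<Rightarrow> real \<Rightarrow> real \<times> real \<times> 'z \<Rightarrow> real" where
  "score_rho mx my sx sy fZ \<rho> = (\<lambda>w. deriv (\<lambda>r. ln (ganm_density mx my sx sy fZ r w)) \<rho>)"

definition sq_integrable_fns :: "'w measure \<Rightarrow> ('w \<Rightarrow> 'z::topological_space) \<Rightarrow> ('z \<Rightarrow> real) set" where
  "sq_integrable_fns M Z = {b \<in> borel_measurable borel. integrable M (\<lambda>\<omega>. (b (Z \<omega>))\<^sup>2)}"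

definition Lambda1 ::
  "('z \<Rightarrow> real) \<Rightarrow> ('z \<Rightarrow> real) \<Rightarrow> real \<Rightarrow> real \<Rightarrow> real \<Rightarrow> (real \<times> real \<times> 'z \<Rightarrow> real) set" where
  "Lambda1 mx my sx sy \<rho> = {(\<lambda>(x, y, z).
      c * (- 1 / sx + 1 / (1 - \<rho>\<^sup>2) * ((x - mx z)\<^sup>2 / sx ^ 3)
           - \<rho> / (1 - \<rho>\<^sup>2) * ((x - mx z) * (y - my z) / (sx\<^sup>2 * sy)))) | c :: real. True}"

definition Lambda2 ::
  "('z \<Rightarrow> real) \<Rightarrow> ('z \<Rightarrow> real) \<Rightarrow> real \<Rightarrow> real \<Rightarrow> real \<Rightarrow> (real \<times> real \<times> 'z \<Rightarrow> real) set" where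
  "Lambda2 mx my sx sy \<rho> = {(\<lambda>(x, y, z).
      c * (- 1 / sy + 1 / (1 - \<rho>\<^sup>2) * ((y - my z)\<^sup>2 / sy ^ 3)
           - \<rho> / (1 - \<rho>\<^sup>2) * ((x - mx z) * (y - my z) / (sx * sy\<^sup>2)))) | c :: real. True}"

definition Lambda3 ::
  "'w measure \<Rightarrow> ('w \<Rightarrow> 'z::topological_space) \<Rightarrow> ('z \<Rightarrow> real) \<Rightarrow> ('z \<Rightarrow> real) \<Rightarrow> real \<Rightarrow> real \<Rightarrow> real \<Rightarrow>
   (real \<times> real \<times> 'z \<Rightarrow> real) set" where
  "Lambda3 M Z mx my sx sy \<rho> = {(\<lambda>(x, y, z).
      1 / (1 - \<rho>\<^sup>2) * ((x - mx z) / sx\<^sup>2 - \<rho> * ((y - my z) / (sx * sy))) * B z)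
      | B. B \<in> sq_integrable_fns M Z}"

definition Lambda4 ::
  "'w measure \<Rightarrow> ('w \<Rightarrow> 'z::topological_space) \<Rightarrow> ('z \<Rightarrow> real) \<Rightarrow> ('z \<Rightarrow> real) \<Rightarrow> real \<Rightarrow> real \<Rightarrow> real \<Rightarrow>
   (real \<times> real \<times> 'z \<Rightarrow> real) set" where
  "Lambda4 M Z mx my sx sy \<rho> = {(\<lambda>(x, y, z).
      1 / (1 - \<rho>\<^sup>2) * ((y - my z) / sy\<^sup>2 - \<rho> * ((x - mx z) / (sx * sy))) * B z)
      | B. B \<in> sq_integrable_fns M Z}"

definition Lambda5 ::
  "'w measure \<Rightarrow> ('w \<Rightarrow> 'z::topological_space) \<Rightarrow> (real \<times> real \<times> 'z \<Rightarrow> real) set" where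
  "Lambda5 M Z = {(\<lambda>(x, y, z). a z)
      | a. a \<in> sq_integrable_fns M Z \<and> (\<integral>\<omega>. a (Z \<omega>) \<partial>M) = 0}"

definition nuisance_tangent_space ::
  "'w measure \<Rightarrow> ('w \<Rightarrow> 'z::topological_space) \<Rightarrow> ('z \<Rightarrow> real) \<Rightarrow> ('z \<Rightarrow> real) \<Rightarrow> real \<Rightarrow> real \<Rightarrow> real \<Rightarrow>
   (real \<times> real \<times> 'z \<Rightarrow> real) set" where
  "nuisance_tangent_space M Z mx my sx sy \<rho> =
     {(\<lambda>w. g1 w + g2 w + g3 w + g4 w + g5 w) | g1 g2 g3 g4 g5.
        g1 \<in> Lambda1 mx my sx sy \<rho> \<and> g2 \<in> Lambda2 mx my sx sy \<rho> \<and>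
        g3 \<in> Lambda3 M Z mx my sx sy \<rho> \<and> g4 \<in> Lambda4 M Z mx my sx sy \<rho> \<and>
        g5 \<in> Lambda5 M Z}"

definition is_efficient_score ::
  "'w measure \<Rightarrow> ('w \<Rightarrow> real) \<Rightarrow> ('w \<Rightarrow> real) \<Rightarrow> ('w \<Rightarrow> 'z::topological_space) \<Rightarrow>
   ('z \<Rightarrow> real) \<Rightarrow> ('z \<Rightarrow> real) \<Rightarrow> real \<Rightarrow> real \<Rightarrow> ('z \<Rightarrow> real) \<Rightarrow> real \<Rightarrow>
   (real \<times> real \<times> 'z \<Rightarrow> real) \<Rightarrow> bool" where
  "is_efficient_score M X Y Z mx my sx sy fZ \<rho> S \<longleftrightarrow>
     is_orth_projection M (\<lambda>\<omega>. (X \<omega>, Y \<omega>, Z \<omega>))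
       (orth_compl M (\<lambda>\<omega>. (X \<omega>, Y \<omega>, Z \<omega>)) (nuisance_tangent_space M Z mx my sx sy \<rho>))
       (score_rho mx my sx sy fZ \<rho>) S"

definition is_efficiency_bound ::
  "'w measure \<Rightarrow> ('w \<Rightarrow> real) \<Rightarrow> ('w \<Rightarrow> real) \<Rightarrow> ('w \<Rightarrow> 'z::topological_space) \<Rightarrow>
   ('z \<Rightarrow> real) \<Rightarrow> ('z \<Rightarrow> real) \<Rightarrow> real \<Rightarrow> real \<Rightarrow> ('z \<Rightarrow> real) \<Rightarrow> real \<Rightarrow> real \<Rightarrow> bool" where
  "is_efficiency_bound M X Y Z mx my sx sy fZ \<rho> b \<longleftrightarrow>
     (\<exists>S. is_efficient_score M X Y Z mx my sx sy fZ \<rho> S \<and>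
          b = inverse (\<integral>\<omega>. (S (X \<omega>, Y \<omega>, Z \<omega>))\<^sup>2 \<partial>M))"

definition is_efficient_influence_function ::
  "'w measure \<Rightarrow> ('w \<Rightarrow> real) \<Rightarrow> ('w \<Rightarrow> real) \<Rightarrow> ('w \<Rightarrow> 'z::topological_space) \<Rightarrow>
   ('z \<Rightarrow> real) \<Rightarrow> ('z \<Rightarrow> real) \<Rightarrow> real \<Rightarrow> real \<Rightarrow> ('z \<Rightarrow> real) \<Rightarrow> real \<Rightarrow>
   (real \<times> real \<times> 'z \<Rightarrow> real) \<Rightarrow> bool" where
  "is_efficient_influence_function M X Y Z mx my sx sy fZ \<rho> \<phi> \<longleftrightarrow>
     (\<exists>S. is_efficient_score M X Y Z mx my sx sy fZ \<rho> S \<and>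
          \<phi> = (\<lambda>w. inverse (\<integral>\<omega>. (S (X \<omega>, Y \<omega>, Z \<omega>))\<^sup>2 \<partial>M) * S w))"

end

theory Submission
  imports Defs
begin

text \<open>
  Write \<open>U = (x - m\<^sub>x z) / \<sigma>\<^sub>x\<close>, \<open>s = sqrt (1 - \<rho>\<^sup>2)\<close> and let \<open>V\<close> be the standardised residual
  of the second error after regression on the first, so that
  \<open>(y - m\<^sub>y z) / \<sigma>\<^sub>y = \<rho> U + s V\<close>. An affine change of variables shows that \<open>U\<close>, \<open>V\<close> and \<open>Z\<close> are
  independent and that \<open>U\<close> and \<open>V\<close> are standard normal (\<open>distributed_standardised\<close>). In these
  coordinates every score is a polynomial in \<open>U\<close> and \<open>V\<close> of degree at most two,
  possibly multiplied by a function of \<open>Z\<close>, and all inner products reduce to Gaussian moments up to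
  order four (\<open>moment_U_V_Z\<close>).

  The nuisance tangent space becomes
  \<^item> \<open>\<Lambda>\<^sub>1\<close>: multiples of \<open>U\<^sup>2 - 1 - (\<rho> / s) U V\<close>;
  \<^item> \<open>\<Lambda>\<^sub>2\<close>: multiples of \<open>V\<^sup>2 - 1 + (\<rho> / s) U V\<close>;
  \<^item> \<open>\<Lambda>\<^sub>3\<close> and \<open>\<Lambda>\<^sub>4\<close>: \<open>U - (\<rho> / s) V\<close> and \<open>V\<close>, each times a function of \<open>Z\<close>;
  \<^item> \<open>\<Lambda>\<^sub>5\<close>: centred functions of \<open>Z\<close>.

  The score for \<open>\<rho>\<close> is a centred quadratic form in \<open>(U, V)\<close>. It is therefore orthogonal to
  \<open>\<Lambda>\<^sub>3\<close>, \<open>\<Lambda>\<^sub>4\<close> (odd degree) and \<open>\<Lambda>\<^sub>5\<close> (independence), and only the two scale scores have to be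
  projected out. The decomposition is explicit: wherever the density is positive,
  \<open>S\<^sub>\<rho> = (\<rho> (U\<^sup>2 - V\<^sup>2) + 2 s U V) / (2 s\<^sup>2) - \<rho> (U\<^sup>2 + V\<^sup>2 - 2) / (2 s\<^sup>2)\<close>
  (\<open>score_rho_eq\<close>). The second summand is a combination of the generators of \<open>\<Lambda>\<^sub>1\<close> and
  \<open>\<Lambda>\<^sub>2\<close> with equal weights, in which the \<open>U V\<close> terms cancel
  (\<open>scale_score_in_tangent_space\<close>); the first is orthogonal to all five spaces
  (\<open>efficient_score_in_orth_compl\<close>). Hence the first summand is the projection of \<open>S\<^sub>\<rho>\<close> onto the
  orthogonal complement, and its second moment
  \<open>(4 \<rho>\<^sup>2 + 4 s\<^sup>2) / (4 s\<^sup>4) = 1 / (1 - \<rho>\<^sup>2)\<^sup>2\<close> gives the bound and the influence function.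
  Every other version of the projection agrees almost surely with this one, so the bound is the same
  for all of them.
\<close>

section \<open>Projections in the Hilbert space of score functions\<close>

lemma integrable_mult_square_integrable:
  fixes f g :: "'a \<Rightarrow> real"
  assumes [measurable]: "f \<in> borel_measurable M" "g \<in> borel_measurable M"
    and "integrable M (\<lambda>x. (f x)\<^sup>2)" "integrable M (\<lambda>x. (g x)\<^sup>2)"
  shows "integrable M (\<lambda>x. f x * g x)"
proof (rule Bochner_Integration.integrable_bound)
  show "integrable M (\<lambda>x. (f x)\<^sup>2 + (g x)\<^sup>2)"
    using assms by auto
  show "AE x in M. norm (f x * g x) \<le> norm ((f x)\<^sup>2 + (g x)\<^sup>2)"
  proof (rule AE_I2)
    fix x
    have "2 * \<bar>f x\<bar> * \<bar>g x\<bar> \<le> (f x)\<^sup>2 + (g x)\<^sup>2"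
      using sum_squares_bound[of "\<bar>f x\<bar>" "\<bar>g x\<bar>"] by simp
    moreover have "0 \<le> \<bar>f x\<bar> * \<bar>g x\<bar>" by simp
    ultimately have "\<bar>f x\<bar> * \<bar>g x\<bar> \<le> (f x)\<^sup>2 + (g x)\<^sup>2" by linarith
    then show "norm (f x * g x) \<le> norm ((f x)\<^sup>2 + (g x)\<^sup>2)"
      by (simp add: abs_mult)
  qed
qed measurable

lemma hilbert_fnsD:
  assumes "f \<in> hilbert_fns M W" and "W \<in> borel_measurable M"
  shows "f \<in> borel_measurable borel" "(\<lambda>\<omega>. f (W \<omega>)) \<in> borel_measurable M"
    "integrable M (\<lambda>\<omega>. f (W \<omega>))" "integrable M (\<lambda>\<omega>. (f (W \<omega>))\<^sup>2)"
    "(\<integral>\<omega>. f (W \<omega>) \<partial>M) = 0"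
  using assms unfolding hilbert_fns_def by (auto intro: measurable_compose)

lemma integrable_hilbert_mult:
  assumes "f \<in> hilbert_fns M W" "g \<in> hilbert_fns M W" and "W \<in> borel_measurable M"
  shows "integrable M (\<lambda>\<omega>. f (W \<omega>) * g (W \<omega>))"
  using assms by (intro integrable_mult_square_integrable) (auto dest: hilbert_fnsD)

lemma hilbert_fns_lincomb:
  assumes f: "f \<in> hilbert_fns M W" and g: "g \<in> hilbert_fns M W" and W: "W \<in> borel_measurable M"
  shows "(\<lambda>w. a * f w + b * g w) \<in> hilbert_fns M W"
proof -
  note F = hilbert_fnsD[OF f W] and G = hilbert_fnsD[OF g W]
  have "integrable M (\<lambda>\<omega>. a\<^sup>2 * (f (W \<omega>))\<^sup>2 + b\<^sup>2 * (g (W \<omega>))\<^sup>2 + 2 * a * b * (f (W \<omega>) * g (W \<omega>)))"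
    using F G integrable_hilbert_mult[OF f g W] by auto
  then have "integrable M (\<lambda>\<omega>. (a * f (W \<omega>) + b * g (W \<omega>))\<^sup>2)"
    by (simp add: power2_eq_square algebra_simps)
  then show ?thesis
    using F G by (auto simp: hilbert_fns_def)
qed

lemma hilbert_fns_cong_AE:
  assumes f: "f \<in> hilbert_fns M W" and W: "W \<in> borel_measurable M"
    and g: "g \<in> borel_measurable borel" and eq: "AE \<omega> in M. g (W \<omega>) = f (W \<omega>)"
  shows "g \<in> hilbert_fns M W"
proof -
  note F = hilbert_fnsD[OF f W]
  have gW[measurable]: "(\<lambda>\<omega>. g (W \<omega>)) \<in> borel_measurable M"
    using W g by (rule measurable_compose)
  note fW[measurable] = F(2)
  have "integrable M (\<lambda>\<omega>. g (W \<omega>))"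
    using F(3) eq by (subst integrable_cong_AE[where g = "\<lambda>\<omega>. f (W \<omega>)"]) auto
  moreover have "integrable M (\<lambda>\<omega>. (g (W \<omega>))\<^sup>2)"
    using F(4) eq by (subst integrable_cong_AE[where g = "\<lambda>\<omega>. (f (W \<omega>))\<^sup>2"]) auto
  moreover have "(\<integral>\<omega>. g (W \<omega>) \<partial>M) = (\<integral>\<omega>. f (W \<omega>) \<partial>M)"
    using eq by (intro integral_cong_AE) auto
  ultimately show ?thesis
    using g F(5) by (simp add: hilbert_fns_def)
qed

text \<open>
  A decomposition \<open>s = p + g\<close> with \<open>p \<in> V\<^sup>\<bottom>\<close> and \<open>g \<in> V\<close> makes \<open>p\<close> the projection onto \<open>V\<^sup>\<bottom>\<close>, because
  \<open>g\<close> is orthogonal to everything that is orthogonal to \<open>V\<close>. The decomposition need only hold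
  almost surely: inner products do not see null sets, and the score for \<open>\<rho>\<close> differs from its
  smooth formula where the density of \<open>Z\<close> vanishes.
\<close>

lemma is_orth_projection_orth_complI:
  assumes W: "W \<in> borel_measurable M"
    and s: "s \<in> borel_measurable borel" and p: "p \<in> orth_compl M W V"
    and g: "g \<in> V" "g \<in> hilbert_fns M W"
    and eq: "AE \<omega> in M. s (W \<omega>) = p (W \<omega>) + g (W \<omega>)"
  shows "is_orth_projection M W (orth_compl M W V) s p"
proof -
  have pH: "p \<in> hilbert_fns M W"
    using p by (simp add: orth_compl_def)
  have sH: "s \<in> hilbert_fns M W"
    using hilbert_fns_cong_AE[OF hilbert_fns_lincomb[OF pH g(2) W, of 1 1] W s] eq by simp
  have dH: "(\<lambda>w. s w - p w) \<in> hilbert_fns M W"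
    using hilbert_fns_lincomb[OF sH pH W, of 1 "- 1"] by simp
  have "inner_fns M W (\<lambda>w. s w - p w) h = 0" if h: "h \<in> orth_compl M W V" for h
  proof -
    have hH: "h \<in> hilbert_fns M W"
      using h by (simp add: orth_compl_def)
    note [measurable] = hilbert_fnsD(2)[OF hH W] hilbert_fnsD(2)[OF sH W]
      hilbert_fnsD(2)[OF pH W] hilbert_fnsD(2)[OF g(2) W]
    have "inner_fns M W (\<lambda>w. s w - p w) h = inner_fns M W h g"
      unfolding inner_fns_def using eq by (intro integral_cong_AE) auto
    also have "\<dots> = 0"
      using h g(1) by (simp add: orth_compl_def)
    finally show ?thesis .
  qed
  then show ?thesis
    using sH dH p by (simp add: is_orth_projection_def orth_compl_def)
qed

text \<open>
  The residuals \<open>s - p\<close> and \<open>s - q\<close> are orthogonal to both \<open>p\<close> and \<open>q\<close>, so \<open>p - q\<close> is orthogonal to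
  itself.
\<close>

lemma is_orth_projection_unique:
  assumes W: "W \<in> borel_measurable M" and V: "V \<subseteq> hilbert_fns M W"
    and p: "is_orth_projection M W V s p" and q: "is_orth_projection M W V s q"
  shows "AE \<omega> in M. p (W \<omega>) = q (W \<omega>)"
proof -
  have pq: "p \<in> V" "q \<in> V"
    and orth: "\<And>h. h \<in> V \<Longrightarrow> inner_fns M W (\<lambda>w. s w - p w) h = 0"
      "\<And>h. h \<in> V \<Longrightarrow> inner_fns M W (\<lambda>w. s w - q w) h = 0"
    and sH: "s \<in> hilbert_fns M W"
    using p q by (auto simp: is_orth_projection_def orth_compl_def)
  have H: "p \<in> hilbert_fns M W" "q \<in> hilbert_fns M W"
    using pq V by auto
  note int = integrable_hilbert_mult[OF _ _ W]
  have eqs: "(\<integral>\<omega>. s (W \<omega>) * h (W \<omega>) \<partial>M) = (\<integral>\<omega>. p (W \<omega>) * h (W \<omega>) \<partial>M)"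
     "(\<integral>\<omega>. s (W \<omega>) * h (W \<omega>) \<partial>M) = (\<integral>\<omega>. q (W \<omega>) * h (W \<omega>) \<partial>M)" if "h \<in> V" for h
    using orth[OF that] int[OF sH] int[OF H(1)] int[OF H(2)] that V
    by (auto simp: inner_fns_def left_diff_distrib subset_iff)
  have d: "(\<lambda>w. p w - q w) \<in> hilbert_fns M W"
    using hilbert_fns_lincomb[OF H W, of 1 "- 1"] by simp
  have "(\<integral>\<omega>. (p (W \<omega>) - q (W \<omega>))\<^sup>2 \<partial>M)
      = (\<integral>\<omega>. (p (W \<omega>) * p (W \<omega>) - q (W \<omega>) * p (W \<omega>)) - (p (W \<omega>) * q (W \<omega>) - q (W \<omega>) * q (W \<omega>)) \<partial>M)"
    by (simp add: power2_eq_square algebra_simps)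
  also have "\<dots> = 0"
    using eqs[OF pq(1)] eqs[OF pq(2)] int[OF H(1) H(1)] int[OF H(1) H(2)] int[OF H(2) H(1)] int[OF H(2) H(2)]
    by (simp add: mult.commute)
  finally have "AE \<omega> in M. (p (W \<omega>) - q (W \<omega>))\<^sup>2 = 0"
    using hilbert_fnsD(4)[OF d W] by (subst (asm) integral_nonneg_eq_0_iff_AE) auto
  then show ?thesis
    by simp
qed

section \<open>Change of variables and Gaussian moments\<close>

lemma (in pair_sigma_finite) has_bochner_integral_pair_mult:
  fixes f :: "'a \<Rightarrow> real" and g :: "'b \<Rightarrow> real"
  assumes f: "integrable M1 f" and g: "integrable M2 g"
  shows "has_bochner_integral (M1 \<Otimes>\<^sub>M M2) (\<lambda>(x, y). f x * g y) ((\<integral>x. f x \<partial>M1) * (\<integral>y. g y \<partial>M2))"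
proof -
  have [measurable]: "f \<in> borel_measurable M1" "g \<in> borel_measurable M2"
    using f g by auto
  have "integrable (M1 \<Otimes>\<^sub>M M2) (\<lambda>(x, y). f x * g y)"
    using f g by (intro Fubini_integrable) (auto simp: abs_mult)
  then show ?thesis
    using integral_fst'[of "\<lambda>(x, y). f x * g y"] by (simp add: has_bochner_integral_iff)
qed

text \<open>
  For fixed \<open>z\<close> the map \<open>(u, v) \<mapsto> (m z + a u, n z + c u + b v)\<close> is affine and triangular, so its Jacobian
  determinant is \<open>a b\<close> whatever the shear \<open>c\<close> and the shifts are. Since the shifts vary with \<open>z\<close> only
  measurably, the map is not covered by differentiable substitution; instead each real variable is
  substituted separately, with the other two held fixed.
\<close>

lemma nn_integral_lborel_shear:
  fixes h :: "real \<times> real \<times> 'z::euclidean_space \<Rightarrow> ennreal" and m n :: "'z \<Rightarrow> real"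
  assumes [measurable]: "h \<in> borel_measurable borel" "m \<in> borel_measurable borel"
      "n \<in> borel_measurable borel"
    and "a \<noteq> 0" "b \<noteq> 0"
  shows "(\<integral>\<^sup>+w. h w \<partial>lborel)
    = (\<integral>\<^sup>+(u, v, z). ennreal (\<bar>a\<bar> * \<bar>b\<bar>) * h (m z + a * u, n z + c * u + b * v, z) \<partial>lborel)"
proof -
  have [measurable]: "h \<in> borel_measurable (borel \<Otimes>\<^sub>M borel \<Otimes>\<^sub>M borel)"
    using assms(1) by (simp add: borel_prod)
  have split: "(\<integral>\<^sup>+w. k w \<partial>lborel) = (\<integral>\<^sup>+x. \<integral>\<^sup>+z. \<integral>\<^sup>+y. k (x, y, z) \<partial>lborel \<partial>lborel \<partial>lborel)"
    if k[measurable]: "k \<in> borel_measurable borel" for k :: "real \<times> real \<times> 'z \<Rightarrow> ennreal"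
  proof -
    have "(\<integral>\<^sup>+w. k w \<partial>lborel) = (\<integral>\<^sup>+x. \<integral>\<^sup>+yz. k (x, yz) \<partial>lborel \<partial>lborel)"
      by (subst lborel_prod[symmetric], subst lborel.nn_integral_fst[symmetric]) (simp_all add: lborel_prod borel_prod)
    also have "\<dots> = (\<integral>\<^sup>+x. \<integral>\<^sup>+z. \<integral>\<^sup>+y. k (x, y, z) \<partial>lborel \<partial>lborel \<partial>lborel)"
      by (intro nn_integral_cong, subst lborel_prod[symmetric], subst lborel_pair.nn_integral_snd[symmetric])
        (simp_all only: lborel_prod split_conv, measurable)
    finally show ?thesis .
  qed
  have h': "(\<lambda>(x, y, z). h (m z + a * x, y, z)) \<in> borel_measurable borel"
    unfolding borel_prod[symmetric] by measurable
  have h'': "(\<lambda>(u, v, z). ennreal \<bar>b\<bar> * h (m z + a * u, n z + c * u + b * v, z)) \<in> borel_measurable borel"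
    unfolding borel_prod[symmetric] by measurable
  have swap: "(\<integral>\<^sup>+w. k w \<partial>lborel) = (\<integral>\<^sup>+yz. \<integral>\<^sup>+x. k (x, yz) \<partial>lborel \<partial>lborel)"
    if "k \<in> borel_measurable borel" for k :: "real \<times> real \<times> 'z \<Rightarrow> ennreal"
    using that by (subst lborel_prod[symmetric], subst lborel_pair.nn_integral_snd[symmetric])
      (simp_all add: lborel_prod borel_prod)
  have "(\<integral>\<^sup>+w. h w \<partial>lborel) = (\<integral>\<^sup>+yz. \<integral>\<^sup>+x. h (x, yz) \<partial>lborel \<partial>lborel)"
    by (rule swap) fact
  also have "\<dots> = (\<integral>\<^sup>+yz. ennreal \<bar>a\<bar> * (\<integral>\<^sup>+x. h (m (snd yz) + a * x, yz) \<partial>lborel) \<partial>lborel)"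
    using \<open>a \<noteq> 0\<close> by (intro nn_integral_cong nn_integral_real_affine) measurable
  also have "\<dots> = ennreal \<bar>a\<bar> * (\<integral>\<^sup>+yz. \<integral>\<^sup>+x. h (m (snd yz) + a * x, yz) \<partial>lborel \<partial>lborel)"
    unfolding lborel_prod[symmetric] by (rule nn_integral_cmult) measurable
  also have "(\<integral>\<^sup>+yz. \<integral>\<^sup>+x. h (m (snd yz) + a * x, yz) \<partial>lborel \<partial>lborel)
      = (\<integral>\<^sup>+(x, y, z). h (m z + a * x, y, z) \<partial>lborel)"
    using swap[OF h'] by (simp add: split_beta')
  also have "\<dots> = (\<integral>\<^sup>+x. \<integral>\<^sup>+z. \<integral>\<^sup>+y. h (m z + a * x, y, z) \<partial>lborel \<partial>lborel \<partial>lborel)"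
    using split[OF h'] by simp
  also have "\<dots> = (\<integral>\<^sup>+x. \<integral>\<^sup>+z. ennreal \<bar>b\<bar> *
      (\<integral>\<^sup>+y. h (m z + a * x, n z + c * x + b * y, z) \<partial>lborel) \<partial>lborel \<partial>lborel)"
    using \<open>b \<noteq> 0\<close> by (intro nn_integral_cong nn_integral_real_affine) measurable
  also have "\<dots> = (\<integral>\<^sup>+x. \<integral>\<^sup>+z. \<integral>\<^sup>+y. ennreal \<bar>b\<bar> *
      h (m z + a * x, n z + c * x + b * y, z) \<partial>lborel \<partial>lborel \<partial>lborel)"
    by (intro nn_integral_cong nn_integral_cmult[symmetric]) measurable
  also have "\<dots> = (\<integral>\<^sup>+(u, v, z). ennreal \<bar>b\<bar> * h (m z + a * u, n z + c * u + b * v, z) \<partial>lborel)"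
    using split[OF h''] by simp
  also have "ennreal \<bar>a\<bar> * \<dots>
      = (\<integral>\<^sup>+w. ennreal \<bar>a\<bar> * (case w of (u, v, z) \<Rightarrow> ennreal \<bar>b\<bar> * h (m z + a * u, n z + c * u + b * v, z)) \<partial>lborel)"
    unfolding lborel_prod[symmetric] by (rule nn_integral_cmult[symmetric]) measurable
  also have "\<dots> = (\<integral>\<^sup>+(u, v, z). ennreal (\<bar>a\<bar> * \<bar>b\<bar>) * h (m z + a * u, n z + c * u + b * v, z) \<partial>lborel)"
    by (simp add: split_beta' ennreal_mult mult.assoc)
  finally show ?thesis .
qed

text \<open>
  Here \<open>A\<close>, \<open>B\<close>, \<open>C\<close> stand for \<open>\<epsilon>\<^sub>x\<^sup>2 / \<sigma>\<^sub>x\<^sup>2\<close>, \<open>\<epsilon>\<^sub>x \<epsilon>\<^sub>y / (\<sigma>\<^sub>x \<sigma>\<^sub>y)\<close> and \<open>\<epsilon>\<^sub>y\<^sup>2 / \<sigma>\<^sub>y\<^sup>2\<close>, and \<open>f\<close> for the value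
  of the density of \<open>Z\<close>. The logarithm splits into a sum only for \<open>\<bar>r\<bar> < 1\<close>, which suffices because a
  derivative is local.
\<close>

lemma has_derivative_ln_binormal_density:
  fixes \<rho> sx sy A B C f :: real
  assumes "sx > 0" "sy > 0" "- 1 < \<rho>" "\<rho> < 1" "f > 0"
  shows "((\<lambda>r. ln (1 / (2 * pi * sx * sy * sqrt (1 - r\<^sup>2)) *
            exp (- (1 / (2 * (1 - r\<^sup>2))) * (A - 2 * r * B + C)) * f)) has_real_derivative
          \<rho> / (1 - \<rho>\<^sup>2) + B / (1 - \<rho>\<^sup>2) - \<rho> * (A - 2 * \<rho> * B + C) / (1 - \<rho>\<^sup>2)\<^sup>2) (at \<rho>)"
proof -
  have pos: "0 < 1 - r\<^sup>2" if "r \<in> {-1<..<1}" for r :: real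
    using that by (simp add: abs_square_less_1 abs_less_iff)
  have "((\<lambda>r. ln (f / (2 * pi * sx * sy)) - ln (1 - r\<^sup>2) / 2 - (A - 2 * r * B + C) / (2 * (1 - r\<^sup>2)))
     has_real_derivative
          \<rho> / (1 - \<rho>\<^sup>2) + B / (1 - \<rho>\<^sup>2) - \<rho> * (A - 2 * \<rho> * B + C) / (1 - \<rho>\<^sup>2)\<^sup>2) (at \<rho>)"
  proof -
    define d where "d = 1 - \<rho>\<^sup>2"
    have d: "0 < d" "\<rho>\<^sup>2 = 1 - d"
      using pos[of \<rho>] assms(3,4) by (auto simp: d_def)
    have D1: "((\<lambda>r. ln (1 - r\<^sup>2)) has_real_derivative - (2 * \<rho>) / d) (at \<rho>)"
      using d by (auto intro!: derivative_eq_intros simp: d_def[symmetric])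
    have D2: "((\<lambda>r. (A - 2 * r * B + C) / (2 * (1 - r\<^sup>2))) has_real_derivative
        (- (2 * B) * (2 * d) - (A - 2 * \<rho> * B + C) * (- (4 * \<rho>))) / ((2 * d) * (2 * d))) (at \<rho>)"
      using d by (auto intro!: derivative_eq_intros simp: d_def[symmetric])
    have "- (- (2 * \<rho>) / d / 2) -
        (- (2 * B) * (2 * d) - (A - 2 * \<rho> * B + C) * (- (4 * \<rho>))) / ((2 * d) * (2 * d))
      = \<rho> / d + B / d - \<rho> * (A - 2 * \<rho> * B + C) / d\<^sup>2"
      using d by (simp add: field_simps power2_eq_square)
    then show ?thesis
      using DERIV_diff[OF DERIV_diff[OF DERIV_const DERIV_cdivide[OF D1, of 2]] D2]
      unfolding d_def by simp
  qed
  moreover have "ln (f / (2 * pi * sx * sy)) - ln (1 - r\<^sup>2) / 2 - (A - 2 * r * B + C) / (2 * (1 - r\<^sup>2))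
      = ln (1 / (2 * pi * sx * sy * sqrt (1 - r\<^sup>2)) *
            exp (- (1 / (2 * (1 - r\<^sup>2))) * (A - 2 * r * B + C)) * f)" if "r \<in> {-1<..<1}" for r
    using pos[OF that] assms by (simp add: ln_mult ln_div ln_sqrt field_simps)
  ultimately show ?thesis
    using assms(3,4) by (auto elim!: has_field_derivative_transform_within_open[where S = "{-1<..<1}"])
qed

definition std_normal_moment :: "nat \<Rightarrow> real" where
  "std_normal_moment k = (\<integral>x. std_normal_density x * x ^ k \<partial>lborel)"

lemma std_normal_moment_simps:
  "std_normal_moment 0 = 1" "std_normal_moment (Suc 0) = 0" "std_normal_moment 2 = 1"
  "std_normal_moment 3 = 0" "std_normal_moment 4 = 3"
  using integral_std_normal_moment_even[of 0] integral_std_normal_moment_even[of 1]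
    integral_std_normal_moment_even[of 2]
    integral_std_normal_moment_odd[of 0] integral_std_normal_moment_odd[of 1]
  by (simp_all add: std_normal_moment_def fact_numeral numeral_3_eq_3)

section \<open>The Gaussian additive noise model in standardised coordinates\<close>

locale gaussian_anm = prob_space M
  for M :: "'w measure" +
  fixes X Y :: "'w \<Rightarrow> real"
    and Z :: "'w \<Rightarrow> 'z::euclidean_space"
    and mx my fZ :: "'z \<Rightarrow> real"
    and sx sy \<rho> :: real
  assumes sx_pos: "sx > 0" and sy_pos: "sy > 0" and rho_bounds: "- 1 < \<rho>" "\<rho> < 1"
    and mx_measurable [measurable]: "mx \<in> borel_measurable borel"
    and my_measurable [measurable]: "my \<in> borel_measurable borel"
    and fZ_nonneg: "\<And>z. fZ z \<ge> 0"
    and distributed_Z: "distributed M lborel Z (\<lambda>z. ennreal (fZ z))"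
    and distributed_XYZ: "distributed M lborel (\<lambda>\<omega>. (X \<omega>, Y \<omega>, Z \<omega>))
          (\<lambda>w. ennreal (ganm_density mx my sx sy fZ \<rho> w))"
begin

abbreviation W :: "'w \<Rightarrow> real \<times> real \<times> 'z" where
  "W \<equiv> \<lambda>\<omega>. (X \<omega>, Y \<omega>, Z \<omega>)"

definition s :: real where
  "s = sqrt (1 - \<rho>\<^sup>2)"

text \<open>
  The standardised first error, and the standardised residual of the second error after linear
  regression on the first.
\<close>

definition U :: "real \<times> real \<times> 'z \<Rightarrow> real" where
  "U = (\<lambda>(x, y, z). (x - mx z) / sx)"

definition V :: "real \<times> real \<times> 'z \<Rightarrow> real" where
  "V = (\<lambda>(x, y, z). ((y - my z) / sy - \<rho> * ((x - mx z) / sx)) / s)"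

lemma s_pos: "s > 0"
  using rho_bounds by (simp add: s_def abs_square_less_1 abs_less_iff)

lemma s_squared: "s\<^sup>2 = 1 - \<rho>\<^sup>2"
  using rho_bounds by (simp add: s_def abs_square_le_1 abs_le_iff)

lemma rho_squared: "\<rho>\<^sup>2 = 1 - s\<^sup>2"
  by (simp add: s_squared)

lemma eps_x_eq: "x - mx z = sx * U (x, y, z)"
  using sx_pos by (simp add: U_def)

lemma eps_y_eq: "y - my z = sy * (\<rho> * U (x, y, z) + s * V (x, y, z))"
  using sy_pos s_pos by (simp add: U_def V_def)

lemma measurable_W [measurable]:
  "X \<in> borel_measurable M" "Y \<in> borel_measurable M" "Z \<in> borel_measurable M" "W \<in> borel_measurable M"
proof -
  show W: "W \<in> borel_measurable M"
    using distributed_measurable[OF distributed_XYZ] by simp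
  then have "W \<in> M \<rightarrow>\<^sub>M borel \<Otimes>\<^sub>M borel \<Otimes>\<^sub>M borel"
    by (simp add: borel_prod)
  note [measurable] = this
  have "(\<lambda>\<omega>. fst (W \<omega>)) \<in> borel_measurable M" "(\<lambda>\<omega>. fst (snd (W \<omega>))) \<in> borel_measurable M"
    "(\<lambda>\<omega>. snd (snd (W \<omega>))) \<in> borel_measurable M"
    by measurable
  then show "X \<in> borel_measurable M" "Y \<in> borel_measurable M" "Z \<in> borel_measurable M"
    by simp_all
qed

lemma fZ_measurable [measurable]: "fZ \<in> borel_measurable borel"
  using distributed_real_measurable[OF _ distributed_Z] fZ_nonneg by simp

lemma measurable_U_V [measurable]: "U \<in> borel_measurable borel" "V \<in> borel_measurable borel"
  unfolding U_def V_def borel_prod[symmetric] by measurable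

text \<open>
  Inserting \<open>\<epsilon>\<^sub>y / \<sigma>\<^sub>y = \<rho> p + s q\<close> completes the square: the quadratic form in the exponent becomes
  \<open>s\<^sup>2 (p\<^sup>2 + q\<^sup>2)\<close>, and the factor \<open>\<sigma>\<^sub>x \<sigma>\<^sub>y s\<close> is the Jacobian determinant of the substitution.
\<close>

lemma ganm_density_standardised:
  "sx * (sy * s) * ganm_density mx my sx sy fZ \<rho> (mx z + sx * p, my z + sy * \<rho> * p + sy * s * q, z)
    = std_normal_density p * (std_normal_density q * fZ z)"
proof -
  have "(sx * p)\<^sup>2 / sx\<^sup>2 - 2 * \<rho> * ((sx * p) * (sy * \<rho> * p + sy * s * q) / (sx * sy))
      + (sy * \<rho> * p + sy * s * q)\<^sup>2 / sy\<^sup>2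
    = p\<^sup>2 - 2 * \<rho> * (p * (\<rho> * p + s * q)) + (\<rho> * p + s * q)\<^sup>2"
    using sx_pos sy_pos by (simp add: field_simps power2_eq_square)
  also have "\<dots> = p\<^sup>2 - \<rho>\<^sup>2 * p\<^sup>2 + s\<^sup>2 * q\<^sup>2"
    by (simp add: algebra_simps power2_eq_square)
  also have "\<dots> = s\<^sup>2 * (p\<^sup>2 + q\<^sup>2)"
    by (simp add: rho_squared algebra_simps)
  finally have exponent: "- (1 / (2 * (1 - \<rho>\<^sup>2))) * ((sx * p)\<^sup>2 / sx\<^sup>2
      - 2 * \<rho> * ((sx * p) * (sy * \<rho> * p + sy * s * q) / (sx * sy))
      + (sy * \<rho> * p + sy * s * q)\<^sup>2 / sy\<^sup>2) = - (p\<^sup>2 / 2) + - (q\<^sup>2 / 2)"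
    using s_pos by (simp add: s_squared[symmetric] field_simps)
  have "ganm_density mx my sx sy fZ \<rho> (mx z + sx * p, my z + sy * \<rho> * p + sy * s * q, z)
      = 1 / (2 * pi * sx * sy * s) * (exp (- (p\<^sup>2 / 2)) * exp (- (q\<^sup>2 / 2))) * fZ z"
    unfolding ganm_density_def split_conv add.assoc add_diff_cancel_left' exponent
      s_def[symmetric] exp_add by (rule refl)
  moreover have "std_normal_density p * std_normal_density q
      = 1 / (2 * pi) * (exp (- (p\<^sup>2 / 2)) * exp (- (q\<^sup>2 / 2)))"
    by (simp add: std_normal_density_def)
  ultimately show ?thesis
    using sx_pos sy_pos s_pos by (simp add: mult.assoc[symmetric])
qed

text \<open>
  The joint density is a product, which says at once that \<open>U\<close>, \<open>V\<close>, \<open>Z\<close> are independent and that \<open>U\<close> and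
  \<open>V\<close> are standard normal.
\<close>

lemma distributed_standardised:
  "distributed M lborel (\<lambda>\<omega>. (U (W \<omega>), V (W \<omega>), Z \<omega>))
     (\<lambda>w. ennreal (case w of (p, q, z) \<Rightarrow> std_normal_density p * (std_normal_density q * fZ z)))"
proof -
  let ?T = "\<lambda>w. (U w, V w, snd (snd w))"
  let ?d = "\<lambda>w. case w of (p, q, z) \<Rightarrow> std_normal_density p * (std_normal_density q * fZ z)"
  let ?g = "ganm_density mx my sx sy fZ \<rho>"
  have T[measurable]: "?T \<in> borel \<rightarrow>\<^sub>M borel"
    using measurable_U_V unfolding borel_prod[symmetric] by measurable
  have TW[measurable]: "(\<lambda>\<omega>. (U (W \<omega>), V (W \<omega>), Z \<omega>)) \<in> M \<rightarrow>\<^sub>M lborel"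
    using measurable_compose[OF measurable_W(4) T] by simp
  have d[measurable]: "(\<lambda>w. ennreal (?d w)) \<in> borel_measurable lborel"
    unfolding lborel_prod[symmetric] by measurable
  have g[measurable]: "(\<lambda>w. ennreal (?g w)) \<in> borel_measurable borel"
    using distributed_XYZ by (simp add: distributed_def)
  \<comment> \<open>The substitution below inverts \<open>?T\<close>, so it turns the integral of \<open>indicator A (?T w)\<close> into one of
    \<open>indicator A\<close> itself.\<close>
  have inv: "?T (mx z + sx * p, my z + sy * \<rho> * p + sy * s * q, z) = (p, q, z)" for p q z
    using sx_pos sy_pos s_pos by (simp add: U_def V_def add_divide_distrib)
  have scale: "ennreal (\<bar>sx\<bar> * \<bar>sy * s\<bar>) *
      (ennreal (?g (mx z + sx * p, my z + sy * \<rho> * p + sy * s * q, z)) * c) = ennreal (?d (p, q, z)) * c"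
    for p q z and c :: ennreal
  proof -
    have "ennreal (\<bar>sx\<bar> * \<bar>sy * s\<bar>) * ennreal (?g (mx z + sx * p, my z + sy * \<rho> * p + sy * s * q, z))
        = ennreal (sx * (sy * s) * ?g (mx z + sx * p, my z + sy * \<rho> * p + sy * s * q, z))"
      using sx_pos sy_pos s_pos by (subst ennreal_mult'[symmetric]) simp_all
    then show ?thesis
      unfolding ganm_density_standardised by (simp only: split_conv mult.assoc[symmetric])
  qed
  have "distr M lborel (\<lambda>\<omega>. (U (W \<omega>), V (W \<omega>), Z \<omega>)) = density lborel (\<lambda>w. ennreal (?d w))"
  proof (rule measure_eqI)
    fix A assume "A \<in> sets (distr M lborel (\<lambda>\<omega>. (U (W \<omega>), V (W \<omega>), Z \<omega>)))"
    then have A[measurable]: "A \<in> sets borel" by simp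
    have "emeasure (distr M lborel (\<lambda>\<omega>. (U (W \<omega>), V (W \<omega>), Z \<omega>))) A
        = (\<integral>\<^sup>+w. indicator A w \<partial>distr M lborel (\<lambda>\<omega>. (U (W \<omega>), V (W \<omega>), Z \<omega>)))"
      using A by simp
    also have "\<dots> = (\<integral>\<^sup>+\<omega>. indicator A (?T (W \<omega>)) \<partial>M)"
      using A TW by (subst nn_integral_distr) auto
    also have "\<dots> = (\<integral>\<^sup>+w. ennreal (?g w) * indicator A (?T w) \<partial>lborel)"
      using measurable_compose[OF T borel_measurable_indicator[OF A]]
      by (intro distributed_nn_integral[OF distributed_XYZ, symmetric]) simp
    also have "\<dots> = (\<integral>\<^sup>+(p, q, z). ennreal (\<bar>sx\<bar> * \<bar>sy * s\<bar>) *
        (ennreal (?g (mx z + sx * p, my z + sy * \<rho> * p + sy * s * q, z)) *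
          indicator A (?T (mx z + sx * p, my z + sy * \<rho> * p + sy * s * q, z))) \<partial>lborel)"
      using sx_pos sy_pos s_pos measurable_compose[OF T borel_measurable_indicator[OF A]] g
      by (intro nn_integral_lborel_shear borel_measurable_times_ennreal) simp_all
    also have "\<dots> = (\<integral>\<^sup>+w. ennreal (?d w) * indicator A w \<partial>lborel)"
      using scale by (intro nn_integral_cong) (simp only: inv split_beta' prod.collapse)
    also have "\<dots> = emeasure (density lborel (\<lambda>w. ennreal (?d w))) A"
      using d A by (simp add: emeasure_density)
    finally show "emeasure (distr M lborel (\<lambda>\<omega>. (U (W \<omega>), V (W \<omega>), Z \<omega>))) A
        = emeasure (density lborel (\<lambda>w. ennreal (?d w))) A" .
  qed simp
  then show ?thesis
    using TW d by (simp add: distributed_def)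
qed

lemma moment_U_V_Z:
  assumes [measurable]: "b \<in> borel_measurable borel" and "integrable M (\<lambda>\<omega>. b (Z \<omega>))"
  shows "has_bochner_integral M (\<lambda>\<omega>. U (W \<omega>) ^ i * V (W \<omega>) ^ j * b (Z \<omega>))
           (std_normal_moment i * std_normal_moment j * expectation (\<lambda>\<omega>. b (Z \<omega>)))"
proof -
  let ?d = "\<lambda>w. case w of (p, q, z) \<Rightarrow> std_normal_density p * (std_normal_density q * fZ z)"
  let ?h = "\<lambda>w. case w of (p, q, z) \<Rightarrow> p ^ i * q ^ j * b z"
  have h[measurable]: "?h \<in> borel_measurable lborel"
    unfolding lborel_prod[symmetric] by measurable
  have nonneg: "0 \<le> ?d w" for w
    using fZ_nonneg by (auto split: prod.split)
  have b: "has_bochner_integral lborel (\<lambda>z. fZ z * b z) (expectation (\<lambda>\<omega>. b (Z \<omega>)))"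
    using distributed_integrable[OF distributed_Z, of b] distributed_integral[OF distributed_Z, of b]
      assms fZ_nonneg by (simp add: has_bochner_integral_iff)
  have "has_bochner_integral (lborel \<Otimes>\<^sub>M lborel)
     (\<lambda>(q, z). (std_normal_density q * q ^ j) * (fZ z * b z))
     (std_normal_moment j * expectation (\<lambda>\<omega>. b (Z \<omega>)))"
    using lborel_pair.has_bochner_integral_pair_mult[OF integrable_std_normal_moment[of j] integrable.intros[OF b]]
    by (simp add: std_normal_moment_def has_bochner_integral_integral_eq[OF b])
  note qz = this[unfolded lborel_prod]
  have "has_bochner_integral (lborel \<Otimes>\<^sub>M lborel)
     (\<lambda>(p, y). (std_normal_density p * p ^ i) * (case y of (q, z) \<Rightarrow> (std_normal_density q * q ^ j) * (fZ z * b z)))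
     (std_normal_moment i * (std_normal_moment j * expectation (\<lambda>\<omega>. b (Z \<omega>))))"
    using lborel_pair.has_bochner_integral_pair_mult[OF integrable_std_normal_moment[of i] integrable.intros[OF qz]]
    by (simp add: std_normal_moment_def has_bochner_integral_integral_eq[OF qz])
  then have "has_bochner_integral lborel (\<lambda>w. ?d w * ?h w)
      (std_normal_moment i * std_normal_moment j * expectation (\<lambda>\<omega>. b (Z \<omega>)))"
    unfolding lborel_prod by (simp add: split_beta' ac_simps)
  then show ?thesis
    using distributed_integrable[OF distributed_standardised h nonneg]
      distributed_integral[OF distributed_standardised h nonneg]
    by (simp add: has_bochner_integral_iff)
qed

lemma moment_U_V:
  "has_bochner_integral M (\<lambda>\<omega>. U (W \<omega>) ^ i * V (W \<omega>) ^ j) (std_normal_moment i * std_normal_moment j)"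
proof -
  have "integrable M (\<lambda>\<omega>. 1 :: real)"
    by (rule integrable_const)
  from moment_U_V_Z[OF borel_measurable_const this, of i j] show ?thesis
    unfolding lebesgue_integral_const prob_space real_scaleR_def mult_1_right .
qed

section \<open>The nuisance tangent space\<close>

text \<open>
  In \<open>\<Lambda>\<^sub>1\<close> and \<open>\<Lambda>\<^sub>3\<close> the share \<open>\<rho> U\<close> of the second error adds \<open>- \<rho>\<^sup>2\<close> to the leading coefficient, and
  \<open>1 - \<rho>\<^sup>2 = s\<^sup>2\<close> cancels the prefactor. The generators of \<open>\<Lambda>\<^sub>2\<close> and \<open>\<Lambda>\<^sub>4\<close> instead contain the factor
  \<open>\<epsilon>\<^sub>y / \<sigma>\<^sub>y - \<rho> \<epsilon>\<^sub>x / \<sigma>\<^sub>x = s V\<close>.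
\<close>

lemma Lambda1_eq:
  "Lambda1 mx my sx sy \<rho> = {(\<lambda>w. c / sx * ((U w)\<^sup>2 - 1 - \<rho> / s * (U w * V w))) | c. True}"
proof -
  have key: "- 1 / sx + 1 / s\<^sup>2 * ((sx * p)\<^sup>2 / sx ^ 3)
      - \<rho> / s\<^sup>2 * (sx * p * (sy * (\<rho> * p + s * q)) / (sx\<^sup>2 * sy))
    = (p\<^sup>2 - 1 - \<rho> / s * (p * q)) / sx" for p q
  proof -
    have "- 1 / sx + 1 / s\<^sup>2 * ((sx * p)\<^sup>2 / sx ^ 3)
      - \<rho> / s\<^sup>2 * (sx * p * (sy * (\<rho> * p + s * q)) / (sx\<^sup>2 * sy))
      = (- 1 + (1 - \<rho>\<^sup>2) * p\<^sup>2 / s\<^sup>2 - \<rho> / s * (p * q)) / sx"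
      using sx_pos sy_pos s_pos by (simp add: field_simps power2_eq_square power3_eq_cube)
    then show ?thesis
      using s_pos by (simp add: s_squared[symmetric])
  qed
  have "(\<lambda>(x, y, z). c * (- 1 / sx + 1 / (1 - \<rho>\<^sup>2) * ((x - mx z)\<^sup>2 / sx ^ 3)
           - \<rho> / (1 - \<rho>\<^sup>2) * ((x - mx z) * (y - my z) / (sx\<^sup>2 * sy))))
    = (\<lambda>w. c / sx * ((U w)\<^sup>2 - 1 - \<rho> / s * (U w * V w)))" (is "?l = ?r") for c
  proof
    fix w show "?l w = ?r w"
    proof (cases w)
      case (fields x y z)
      show ?thesis
        unfolding fields split_conv s_squared[symmetric] eps_x_eq[of x z y] eps_y_eq[of y z x] key
        by simp
    qed
  qed
  then show ?thesis
    unfolding Lambda1_def by simp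
qed

lemma Lambda2_eq:
  "Lambda2 mx my sx sy \<rho> = {(\<lambda>w. c / sy * ((V w)\<^sup>2 - 1 + \<rho> / s * (U w * V w))) | c. True}"
proof -
  have key: "- 1 / sy + 1 / s\<^sup>2 * ((sy * (\<rho> * p + s * q))\<^sup>2 / sy ^ 3)
      - \<rho> / s\<^sup>2 * (sx * p * (sy * (\<rho> * p + s * q)) / (sx * sy\<^sup>2))
    = (q\<^sup>2 - 1 + \<rho> / s * (p * q)) / sy" for p q
    using sx_pos sy_pos s_pos by (simp add: field_simps power2_eq_square power3_eq_cube)
  have "(\<lambda>(x, y, z). c * (- 1 / sy + 1 / (1 - \<rho>\<^sup>2) * ((y - my z)\<^sup>2 / sy ^ 3)
           - \<rho> / (1 - \<rho>\<^sup>2) * ((x - mx z) * (y - my z) / (sx * sy\<^sup>2))))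
    = (\<lambda>w. c / sy * ((V w)\<^sup>2 - 1 + \<rho> / s * (U w * V w)))" (is "?l = ?r") for c
  proof
    fix w show "?l w = ?r w"
    proof (cases w)
      case (fields x y z)
      show ?thesis
        unfolding fields split_conv s_squared[symmetric] eps_x_eq[of x z y] eps_y_eq[of y z x] key
        by simp
    qed
  qed
  then show ?thesis
    unfolding Lambda2_def by simp
qed

lemma Lambda3_eq:
  "Lambda3 M Z mx my sx sy \<rho>
    = {(\<lambda>w. 1 / sx * ((U w - \<rho> / s * V w) * B (snd (snd w)))) | B. B \<in> sq_integrable_fns M Z}"
proof -
  have key: "1 / s\<^sup>2 * (sx * p / sx\<^sup>2 - \<rho> * (sy * (\<rho> * p + s * q) / (sx * sy))) = (p - \<rho> / s * q) / sx" for p q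
  proof -
    have "1 / s\<^sup>2 * (sx * p / sx\<^sup>2 - \<rho> * (sy * (\<rho> * p + s * q) / (sx * sy)))
        = ((1 - \<rho>\<^sup>2) * p / s\<^sup>2 - \<rho> / s * q) / sx"
      using sx_pos sy_pos s_pos by (simp add: field_simps power2_eq_square)
    then show ?thesis
      using s_pos by (simp add: s_squared[symmetric])
  qed
  have "(\<lambda>(x, y, z). 1 / (1 - \<rho>\<^sup>2) * ((x - mx z) / sx\<^sup>2 - \<rho> * ((y - my z) / (sx * sy))) * B z)
    = (\<lambda>w. 1 / sx * ((U w - \<rho> / s * V w) * B (snd (snd w))))" (is "?l = ?r") for B
  proof
    fix w show "?l w = ?r w"
    proof (cases w)
      case (fields x y z)
      show ?thesis
        unfolding fields split_conv s_squared[symmetric] eps_x_eq[of x z y] eps_y_eq[of y z x] key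
        by simp
    qed
  qed
  then show ?thesis
    unfolding Lambda3_def by simp
qed

lemma Lambda4_eq:
  "Lambda4 M Z mx my sx sy \<rho>
    = {(\<lambda>w. 1 / (s * sy) * (V w * B (snd (snd w)))) | B. B \<in> sq_integrable_fns M Z}"
proof -
  have key: "1 / s\<^sup>2 * (sy * (\<rho> * p + s * q) / sy\<^sup>2 - \<rho> * (sx * p / (sx * sy))) = q / (s * sy)" for p q
    using sx_pos sy_pos s_pos by (simp add: field_simps power2_eq_square)
  have "(\<lambda>(x, y, z). 1 / (1 - \<rho>\<^sup>2) * ((y - my z) / sy\<^sup>2 - \<rho> * ((x - mx z) / (sx * sy))) * B z)
    = (\<lambda>w. 1 / (s * sy) * (V w * B (snd (snd w))))" (is "?l = ?r") for B
  proof
    fix w show "?l w = ?r w"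
    proof (cases w)
      case (fields x y z)
      show ?thesis
        unfolding fields split_conv s_squared[symmetric] eps_x_eq[of x z y] eps_y_eq[of y z x] key
        by simp
    qed
  qed
  then show ?thesis
    unfolding Lambda4_def by simp
qed

lemma Lambda5_eq:
  "Lambda5 M Z = {(\<lambda>w. a (snd (snd w))) | a. a \<in> sq_integrable_fns M Z \<and> expectation (\<lambda>\<omega>. a (Z \<omega>)) = 0}"
  by (simp add: Lambda5_def split_beta')

lemma sq_integrable_fnsD:
  assumes "b \<in> sq_integrable_fns M Z"
  shows "b \<in> borel_measurable borel" "integrable M (\<lambda>\<omega>. b (Z \<omega>))"
proof -
  show b: "b \<in> borel_measurable borel"
    using assms by (simp add: sq_integrable_fns_def)
  have "integrable M (\<lambda>\<omega>. (b (Z \<omega>))\<^sup>2)"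
    using assms by (simp add: sq_integrable_fns_def)
  then show "integrable M (\<lambda>\<omega>. b (Z \<omega>))"
    by (rule square_integrable_imp_integrable[OF measurable_compose[OF measurable_W(3) b]])
qed

section \<open>Orthogonality to the nuisance tangent space\<close>

text \<open>
  The claimed efficient score, in standardised coordinates; \<open>efficient_score_eq\<close> converts it to the
  original ones.
\<close>

definition efficient_score :: "real \<times> real \<times> 'z \<Rightarrow> real" where
  "efficient_score w = (\<rho> * ((U w)\<^sup>2 - (V w)\<^sup>2) + 2 * s * (U w * V w)) / (2 * s\<^sup>2)"

text \<open>
  In what follows an expectation is computed by writing the integrand as a linear combination of
  monomials \<open>U\<^sup>i V\<^sup>j\<close> (times a function of \<open>Z\<close>), including the trivial powers, so that these rules and
  the moment lemmas evaluate it term by term.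
\<close>

lemmas expectation_polynomial =
  has_bochner_integral_add has_bochner_integral_diff has_bochner_integral_mult_right

text \<open>
  The pure squares contribute \<open>\<rho> E((U\<^sup>2 - V\<^sup>2) (U\<^sup>2 - 1)) = 2 \<rho>\<close> and the mixed terms
  \<open>- 2 \<rho> E(U\<^sup>2 V\<^sup>2) = - 2 \<rho>\<close>; the remaining products are odd in \<open>U\<close> and in \<open>V\<close>. For \<open>\<Lambda>\<^sub>2\<close> below both signs
  are reversed.
\<close>

lemma efficient_score_orth_Lambda1:
  assumes "g \<in> Lambda1 mx my sx sy \<rho>"
  shows "has_bochner_integral M (\<lambda>\<omega>. efficient_score (W \<omega>) * g (W \<omega>)) 0"
proof -
  obtain c where g: "g = (\<lambda>w. c / sx * ((U w)\<^sup>2 - 1 - \<rho> / s * (U w * V w)))"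
    using assms unfolding Lambda1_eq by auto
  let ?m = "\<lambda>i j \<omega>. U (W \<omega>) ^ i * V (W \<omega>) ^ j"
  have "has_bochner_integral M (\<lambda>\<omega>. c / sx / (2 * s\<^sup>2) *
     (\<rho> * ?m 4 0 \<omega> - (\<rho> + 2 * \<rho>) * ?m 2 2 \<omega> + (2 * s - \<rho> * \<rho> / s) * ?m 3 1 \<omega>
      + \<rho> * \<rho> / s * ?m 1 3 \<omega> - \<rho> * ?m 2 0 \<omega> + \<rho> * ?m 0 2 \<omega> - 2 * s * ?m 1 1 \<omega>))
     (c / sx / (2 * s\<^sup>2) *
     (\<rho> * (std_normal_moment 4 * std_normal_moment 0) - (\<rho> + 2 * \<rho>) * (std_normal_moment 2 * std_normal_moment 2)
      + (2 * s - \<rho> * \<rho> / s) * (std_normal_moment 3 * std_normal_moment 1)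
      + \<rho> * \<rho> / s * (std_normal_moment 1 * std_normal_moment 3) - \<rho> * (std_normal_moment 2 * std_normal_moment 0)
      + \<rho> * (std_normal_moment 0 * std_normal_moment 2) - 2 * s * (std_normal_moment 1 * std_normal_moment 1)))"
    by (intro expectation_polynomial moment_U_V)
  moreover have "efficient_score w * g w = c / sx / (2 * s\<^sup>2) *
     (\<rho> * (U w ^ 4 * V w ^ 0) - (\<rho> + 2 * \<rho>) * (U w ^ 2 * V w ^ 2) + (2 * s - \<rho> * \<rho> / s) * (U w ^ 3 * V w ^ 1)
      + \<rho> * \<rho> / s * (U w ^ 1 * V w ^ 3) - \<rho> * (U w ^ 2 * V w ^ 0) + \<rho> * (U w ^ 0 * V w ^ 2)
      - 2 * s * (U w ^ 1 * V w ^ 1))" for w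
    using s_pos sx_pos unfolding efficient_score_def g
    by (simp add: divide_simps) (simp add: algebra_simps power2_eq_square power3_eq_cube power4_eq_xxxx)
  ultimately show ?thesis
    by (simp add: std_normal_moment_simps)
qed

lemma efficient_score_orth_Lambda2:
  assumes "g \<in> Lambda2 mx my sx sy \<rho>"
  shows "has_bochner_integral M (\<lambda>\<omega>. efficient_score (W \<omega>) * g (W \<omega>)) 0"
proof -
  obtain c where g: "g = (\<lambda>w. c / sy * ((V w)\<^sup>2 - 1 + \<rho> / s * (U w * V w)))"
    using assms unfolding Lambda2_eq by auto
  let ?m = "\<lambda>i j \<omega>. U (W \<omega>) ^ i * V (W \<omega>) ^ j"
  let ?e = "\<lambda>i j. std_normal_moment i * std_normal_moment j"
  have "has_bochner_integral M (\<lambda>\<omega>. c / sy / (2 * s\<^sup>2) *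
     ((\<rho> + 2 * \<rho>) * ?m 2 2 \<omega> - \<rho> * ?m 0 4 \<omega> + (2 * s - \<rho> * \<rho> / s) * ?m 1 3 \<omega>
      + \<rho> * \<rho> / s * ?m 3 1 \<omega> - \<rho> * ?m 2 0 \<omega> + \<rho> * ?m 0 2 \<omega> - 2 * s * ?m 1 1 \<omega>))
     (c / sy / (2 * s\<^sup>2) *
     ((\<rho> + 2 * \<rho>) * ?e 2 2 - \<rho> * ?e 0 4 + (2 * s - \<rho> * \<rho> / s) * ?e 1 3
      + \<rho> * \<rho> / s * ?e 3 1 - \<rho> * ?e 2 0 + \<rho> * ?e 0 2 - 2 * s * ?e 1 1))"
    by (intro expectation_polynomial moment_U_V)
  moreover have "efficient_score w * g w = c / sy / (2 * s\<^sup>2) *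
     ((\<rho> + 2 * \<rho>) * (U w ^ 2 * V w ^ 2) - \<rho> * (U w ^ 0 * V w ^ 4) + (2 * s - \<rho> * \<rho> / s) * (U w ^ 1 * V w ^ 3)
      + \<rho> * \<rho> / s * (U w ^ 3 * V w ^ 1) - \<rho> * (U w ^ 2 * V w ^ 0) + \<rho> * (U w ^ 0 * V w ^ 2)
      - 2 * s * (U w ^ 1 * V w ^ 1))" for w
    using s_pos sy_pos unfolding efficient_score_def g
    by (simp add: divide_simps) (simp add: algebra_simps power2_eq_square power3_eq_cube power4_eq_xxxx)
  ultimately show ?thesis
    by (simp add: std_normal_moment_simps)
qed

text \<open>
  Every monomial of odd total degree contains an odd power of \<open>U\<close> or of \<open>V\<close>, and so has mean zero even
  after multiplication by a function of the independent \<open>Z\<close>.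
\<close>

lemma efficient_score_orth_linear:
  assumes "b \<in> sq_integrable_fns M Z"
  shows "has_bochner_integral M (\<lambda>\<omega>. efficient_score (W \<omega>) * (U (W \<omega>) * b (Z \<omega>))) 0"
    and "has_bochner_integral M (\<lambda>\<omega>. efficient_score (W \<omega>) * (V (W \<omega>) * b (Z \<omega>))) 0"
proof -
  let ?m = "\<lambda>i j \<omega>. U (W \<omega>) ^ i * V (W \<omega>) ^ j * b (Z \<omega>)"
  let ?e = "\<lambda>i j. std_normal_moment i * std_normal_moment j * expectation (\<lambda>\<omega>. b (Z \<omega>))"
  note mom = moment_U_V_Z[OF sq_integrable_fnsD[OF assms]]
  have "has_bochner_integral M (\<lambda>\<omega>. 1 / (2 * s\<^sup>2) * (\<rho> * ?m 3 0 \<omega> - \<rho> * ?m 1 2 \<omega> + 2 * s * ?m 2 1 \<omega>))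
     (1 / (2 * s\<^sup>2) * (\<rho> * ?e 3 0 - \<rho> * ?e 1 2 + 2 * s * ?e 2 1))"
    by (intro expectation_polynomial mom)
  moreover have "efficient_score (W \<omega>) * (U (W \<omega>) * b (Z \<omega>))
     = 1 / (2 * s\<^sup>2) * (\<rho> * ?m 3 0 \<omega> - \<rho> * ?m 1 2 \<omega> + 2 * s * ?m 2 1 \<omega>)" for \<omega>
    unfolding efficient_score_def
    by (simp add: divide_simps) (simp add: algebra_simps power2_eq_square power3_eq_cube)
  ultimately show "has_bochner_integral M (\<lambda>\<omega>. efficient_score (W \<omega>) * (U (W \<omega>) * b (Z \<omega>))) 0"
    by (simp add: std_normal_moment_simps)
  have "has_bochner_integral M (\<lambda>\<omega>. 1 / (2 * s\<^sup>2) * (\<rho> * ?m 2 1 \<omega> - \<rho> * ?m 0 3 \<omega> + 2 * s * ?m 1 2 \<omega>))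
     (1 / (2 * s\<^sup>2) * (\<rho> * ?e 2 1 - \<rho> * ?e 0 3 + 2 * s * ?e 1 2))"
    by (intro expectation_polynomial mom)
  moreover have "efficient_score (W \<omega>) * (V (W \<omega>) * b (Z \<omega>))
     = 1 / (2 * s\<^sup>2) * (\<rho> * ?m 2 1 \<omega> - \<rho> * ?m 0 3 \<omega> + 2 * s * ?m 1 2 \<omega>)" for \<omega>
    unfolding efficient_score_def
    by (simp add: divide_simps) (simp add: algebra_simps power2_eq_square power3_eq_cube)
  ultimately show "has_bochner_integral M (\<lambda>\<omega>. efficient_score (W \<omega>) * (V (W \<omega>) * b (Z \<omega>))) 0"
    by (simp add: std_normal_moment_simps)
qed

lemma efficient_score_orth_Lambda3:
  assumes "g \<in> Lambda3 M Z mx my sx sy \<rho>"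
  shows "has_bochner_integral M (\<lambda>\<omega>. efficient_score (W \<omega>) * g (W \<omega>)) 0"
proof -
  obtain b where g: "g = (\<lambda>w. 1 / sx * ((U w - \<rho> / s * V w) * b (snd (snd w))))"
    and b: "b \<in> sq_integrable_fns M Z"
    using assms unfolding Lambda3_eq by auto
  have "has_bochner_integral M (\<lambda>\<omega>. 1 / sx * (efficient_score (W \<omega>) * (U (W \<omega>) * b (Z \<omega>))
      - \<rho> / s * (efficient_score (W \<omega>) * (V (W \<omega>) * b (Z \<omega>))))) (1 / sx * (0 - \<rho> / s * 0))"
    by (intro expectation_polynomial efficient_score_orth_linear b)
  then show ?thesis
    unfolding g by (simp add: algebra_simps)
qed

lemma efficient_score_orth_Lambda4:
  assumes "g \<in> Lambda4 M Z mx my sx sy \<rho>"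
  shows "has_bochner_integral M (\<lambda>\<omega>. efficient_score (W \<omega>) * g (W \<omega>)) 0"
proof -
  obtain b where g: "g = (\<lambda>w. 1 / (s * sy) * (V w * b (snd (snd w))))"
    and b: "b \<in> sq_integrable_fns M Z"
    using assms unfolding Lambda4_eq by auto
  have "has_bochner_integral M (\<lambda>\<omega>. 1 / (s * sy) * (efficient_score (W \<omega>) * (V (W \<omega>) * b (Z \<omega>))))
      (1 / (s * sy) * 0)"
    by (intro expectation_polynomial efficient_score_orth_linear b)
  then show ?thesis
    unfolding g by (simp add: algebra_simps)
qed

text \<open>
  The efficient score is a function of \<open>(U, V)\<close> with mean zero, because \<open>U\<close> and \<open>V\<close> have equal second
  moments and are uncorrelated; independence of \<open>Z\<close> does the rest. Orthogonality to \<open>\<Lambda>\<^sub>5\<close> and, with a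
  constant function, the centring of the efficient score itself are both instances.
\<close>

lemma efficient_score_orth_fn_of_Z:
  assumes "b \<in> borel_measurable borel" "integrable M (\<lambda>\<omega>. b (Z \<omega>))"
  shows "has_bochner_integral M (\<lambda>\<omega>. efficient_score (W \<omega>) * b (Z \<omega>)) 0"
proof -
  let ?m = "\<lambda>i j \<omega>. U (W \<omega>) ^ i * V (W \<omega>) ^ j * b (Z \<omega>)"
  let ?e = "\<lambda>i j. std_normal_moment i * std_normal_moment j * expectation (\<lambda>\<omega>. b (Z \<omega>))"
  have "has_bochner_integral M (\<lambda>\<omega>. 1 / (2 * s\<^sup>2) * (\<rho> * ?m 2 0 \<omega> - \<rho> * ?m 0 2 \<omega> + 2 * s * ?m 1 1 \<omega>))
     (1 / (2 * s\<^sup>2) * (\<rho> * ?e 2 0 - \<rho> * ?e 0 2 + 2 * s * ?e 1 1))"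
    by (intro expectation_polynomial moment_U_V_Z assms)
  moreover have "efficient_score (W \<omega>) * b (Z \<omega>)
     = 1 / (2 * s\<^sup>2) * (\<rho> * ?m 2 0 \<omega> - \<rho> * ?m 0 2 \<omega> + 2 * s * ?m 1 1 \<omega>)" for \<omega>
    unfolding efficient_score_def
    by (simp add: divide_simps) (simp add: algebra_simps power2_eq_square)
  ultimately show ?thesis
    by (simp add: std_normal_moment_simps)
qed

lemma efficient_score_orth_Lambda5:
  assumes "g \<in> Lambda5 M Z"
  shows "has_bochner_integral M (\<lambda>\<omega>. efficient_score (W \<omega>) * g (W \<omega>)) 0"
proof -
  obtain a where "g = (\<lambda>w. a (snd (snd w)))" and "a \<in> sq_integrable_fns M Z"
    using assms unfolding Lambda5_eq by auto
  then show ?thesis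
    using efficient_score_orth_fn_of_Z[OF sq_integrable_fnsD[of a]] by simp
qed

section \<open>The score for \<rho> and its projection\<close>

lemma efficient_score_second_moment:
  "has_bochner_integral M (\<lambda>\<omega>. (efficient_score (W \<omega>))\<^sup>2) (inverse ((1 - \<rho>\<^sup>2)\<^sup>2))"
proof -
  let ?m = "\<lambda>i j \<omega>. U (W \<omega>) ^ i * V (W \<omega>) ^ j"
  let ?e = "\<lambda>i j. std_normal_moment i * std_normal_moment j"
  have "has_bochner_integral M (\<lambda>\<omega>. 1 / (4 * s ^ 4) *
      (\<rho>\<^sup>2 * ?m 4 0 \<omega> - 2 * \<rho>\<^sup>2 * ?m 2 2 \<omega> + \<rho>\<^sup>2 * ?m 0 4 \<omega> + 4 * \<rho> * s * ?m 3 1 \<omega>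
        - 4 * \<rho> * s * ?m 1 3 \<omega> + 4 * s\<^sup>2 * ?m 2 2 \<omega>))
      (1 / (4 * s ^ 4) *
      (\<rho>\<^sup>2 * ?e 4 0 - 2 * \<rho>\<^sup>2 * ?e 2 2 + \<rho>\<^sup>2 * ?e 0 4 + 4 * \<rho> * s * ?e 3 1 - 4 * \<rho> * s * ?e 1 3 + 4 * s\<^sup>2 * ?e 2 2))"
    by (intro expectation_polynomial moment_U_V)
  moreover have "(efficient_score w)\<^sup>2 = 1 / (4 * s ^ 4) *
      (\<rho>\<^sup>2 * (U w ^ 4 * V w ^ 0) - 2 * \<rho>\<^sup>2 * (U w ^ 2 * V w ^ 2) + \<rho>\<^sup>2 * (U w ^ 0 * V w ^ 4) + 4 * \<rho> * s * (U w ^ 3 * V w ^ 1)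
        - 4 * \<rho> * s * (U w ^ 1 * V w ^ 3) + 4 * s\<^sup>2 * (U w ^ 2 * V w ^ 2))" for w
    using s_pos unfolding efficient_score_def
    by (simp add: divide_simps power_mult_distrib) (simp add: algebra_simps power2_eq_square power3_eq_cube power4_eq_xxxx)
  moreover have "1 / (4 * s ^ 4) *
      (\<rho>\<^sup>2 * ?e 4 0 - 2 * \<rho>\<^sup>2 * ?e 2 2 + \<rho>\<^sup>2 * ?e 0 4 + 4 * \<rho> * s * ?e 3 1 - 4 * \<rho> * s * ?e 1 3 + 4 * s\<^sup>2 * ?e 2 2)
      = inverse ((1 - \<rho>\<^sup>2)\<^sup>2)"
    using s_pos by (simp add: std_normal_moment_simps s_squared[symmetric] rho_squared divide_simps)
  ultimately show ?thesis
    by simp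
qed

lemma efficient_score_in_hilbert_fns: "efficient_score \<in> hilbert_fns M W"
proof -
  have "efficient_score \<in> borel_measurable borel"
    unfolding efficient_score_def by measurable
  moreover have "has_bochner_integral M (\<lambda>\<omega>. efficient_score (W \<omega>)) 0"
    using efficient_score_orth_fn_of_Z[OF borel_measurable_const integrable_const, of 1]
    unfolding mult_1_right .
  ultimately show ?thesis
    using efficient_score_second_moment by (simp add: hilbert_fns_def has_bochner_integral_iff)
qed

text \<open>
  The part of the score for \<open>\<rho>\<close> that the scale parameters account for: the derivative of the
  log-likelihood along a direction that rescales both errors by a common factor.
\<close>

definition scale_score :: "real \<times> real \<times> 'z \<Rightarrow> real" where
  "scale_score w = - (\<rho> / (2 * s\<^sup>2)) * ((U w)\<^sup>2 + (V w)\<^sup>2 - 2)"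

lemma scale_score_in_hilbert_fns: "scale_score \<in> hilbert_fns M W"
proof -
  let ?m = "\<lambda>i j \<omega>. U (W \<omega>) ^ i * V (W \<omega>) ^ j"
  let ?e = "\<lambda>i j. std_normal_moment i * std_normal_moment j"
  let ?c = "- (\<rho> / (2 * s\<^sup>2))"
  have "scale_score \<in> borel_measurable borel"
    unfolding scale_score_def by measurable
  moreover have "has_bochner_integral M (\<lambda>\<omega>. ?c * (?m 2 0 \<omega> + ?m 0 2 \<omega> - 2 * ?m 0 0 \<omega>))
      (?c * (?e 2 0 + ?e 0 2 - 2 * ?e 0 0))"
    by (intro expectation_polynomial moment_U_V)
  moreover have "has_bochner_integral M (\<lambda>\<omega>. ?c * ?c *
      (?m 4 0 \<omega> + ?m 0 4 \<omega> + 2 * ?m 2 2 \<omega> - 4 * ?m 2 0 \<omega> - 4 * ?m 0 2 \<omega> + 4 * ?m 0 0 \<omega>))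
      (?c * ?c * (?e 4 0 + ?e 0 4 + 2 * ?e 2 2 - 4 * ?e 2 0 - 4 * ?e 0 2 + 4 * ?e 0 0))"
    by (intro expectation_polynomial moment_U_V)
  moreover have "(scale_score w)\<^sup>2 = ?c * ?c * (U w ^ 4 * V w ^ 0 + U w ^ 0 * V w ^ 4 + 2 * (U w ^ 2 * V w ^ 2)
      - 4 * (U w ^ 2 * V w ^ 0) - 4 * (U w ^ 0 * V w ^ 2) + 4 * (U w ^ 0 * V w ^ 0))" for w
    unfolding scale_score_def
    by (simp add: power_mult_distrib) (simp add: algebra_simps power2_eq_square power4_eq_xxxx)
  ultimately show ?thesis
    by (simp add: hilbert_fns_def has_bochner_integral_iff scale_score_def std_normal_moment_simps)
qed

text \<open>
  The coefficients \<open>- \<rho> \<sigma>\<^sub>x / (2 s\<^sup>2)\<close> and \<open>- \<rho> \<sigma>\<^sub>y / (2 s\<^sup>2)\<close> give the two scale generators the same weight, and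
  their \<open>U V\<close> terms then cancel.
\<close>

lemma scale_score_in_tangent_space: "scale_score \<in> nuisance_tangent_space M Z mx my sx sy \<rho>"
proof -
  have zero: "(\<lambda>_. 0) \<in> sq_integrable_fns M Z"
    by (simp add: sq_integrable_fns_def)
  let ?c = "- (\<rho> / (2 * s\<^sup>2))"
  let ?g1 = "\<lambda>w. ?c * sx / sx * ((U w)\<^sup>2 - 1 - \<rho> / s * (U w * V w))"
  let ?g2 = "\<lambda>w. ?c * sy / sy * ((V w)\<^sup>2 - 1 + \<rho> / s * (U w * V w))"
  have "?g1 \<in> Lambda1 mx my sx sy \<rho>" "?g2 \<in> Lambda2 mx my sx sy \<rho>"
    unfolding Lambda1_eq Lambda2_eq by blast+
  moreover have "(\<lambda>_. 0) \<in> Lambda3 M Z mx my sx sy \<rho>" "(\<lambda>_. 0) \<in> Lambda4 M Z mx my sx sy \<rho>"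
    "(\<lambda>_. 0) \<in> Lambda5 M Z"
    unfolding Lambda3_eq Lambda4_eq Lambda5_eq using zero by force+
  moreover have "scale_score = (\<lambda>w. ?g1 w + ?g2 w + 0 + 0 + 0)"
  proof
    fix w
    have c: "?c * sx / sx = ?c" "?c * sy / sy = ?c"
      using sx_pos sy_pos by simp_all
    have "scale_score w = ?g1 w + ?g2 w"
      unfolding c scale_score_def distrib_left[symmetric]
      by (intro arg_cong2[where f = "(*)"] refl) (simp add: algebra_simps)
    then show "scale_score w = ?g1 w + ?g2 w + 0 + 0 + 0"
      by simp
  qed
  ultimately show ?thesis
    unfolding nuisance_tangent_space_def by (intro CollectI exI conjI)
qed

lemma efficient_score_in_orth_compl:
  "efficient_score \<in> orth_compl M W (nuisance_tangent_space M Z mx my sx sy \<rho>)"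
proof -
  have "inner_fns M W efficient_score g = 0"
    if tangent: "g \<in> nuisance_tangent_space M Z mx my sx sy \<rho>" for g
  proof -
    obtain g1 g2 g3 g4 g5 where g: "g = (\<lambda>w. g1 w + g2 w + g3 w + g4 w + g5 w)"
      and "g1 \<in> Lambda1 mx my sx sy \<rho>" "g2 \<in> Lambda2 mx my sx sy \<rho>"
        "g3 \<in> Lambda3 M Z mx my sx sy \<rho>" "g4 \<in> Lambda4 M Z mx my sx sy \<rho>" "g5 \<in> Lambda5 M Z"
      using tangent unfolding nuisance_tangent_space_def by blast
    then have "has_bochner_integral M (\<lambda>\<omega>. efficient_score (W \<omega>) * g1 (W \<omega>)
        + efficient_score (W \<omega>) * g2 (W \<omega>) + efficient_score (W \<omega>) * g3 (W \<omega>)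
        + efficient_score (W \<omega>) * g4 (W \<omega>) + efficient_score (W \<omega>) * g5 (W \<omega>)) (0 + 0 + 0 + 0 + 0)"
      by (intro has_bochner_integral_add efficient_score_orth_Lambda1 efficient_score_orth_Lambda2
          efficient_score_orth_Lambda3 efficient_score_orth_Lambda4 efficient_score_orth_Lambda5)
    then show ?thesis
      by (simp add: inner_fns_def g distrib_left has_bochner_integral_iff)
  qed
  then show ?thesis
    using efficient_score_in_hilbert_fns by (simp add: orth_compl_def)
qed

text \<open>
  The case distinction reflects \<open>ln 0 = 0\<close>: where the density of \<open>Z\<close> vanishes, the logarithm is constant
  in the correlation. Elsewhere the derivative is
  \<open>\<rho> / s\<^sup>2 + U (\<rho> U + s V) / s\<^sup>2 - \<rho> (U\<^sup>2 + V\<^sup>2) / s\<^sup>2\<close>, and subtracting the scale part leaves the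
  efficient score.
\<close>

lemma score_rho_eq:
  "score_rho mx my sx sy fZ \<rho> w = (if fZ (snd (snd w)) = 0 then 0 else efficient_score w + scale_score w)"
proof (cases w)
  case (fields x y z)
  show ?thesis
  proof (cases "fZ z = 0")
    case True
    then show ?thesis
      by (simp add: fields score_rho_def ganm_density_def)
  next
    case False
    then have "fZ z > 0"
      using fZ_nonneg[of z] by simp
    define p q where "p = U w" and "q = V w"
    have Q: "p\<^sup>2 - 2 * \<rho> * (p * (\<rho> * p + s * q)) + (\<rho> * p + s * q)\<^sup>2 = s\<^sup>2 * (p\<^sup>2 + q\<^sup>2)"
    proof -
      have "p\<^sup>2 - 2 * \<rho> * (p * (\<rho> * p + s * q)) + (\<rho> * p + s * q)\<^sup>2 = (1 - \<rho>\<^sup>2) * p\<^sup>2 + s\<^sup>2 * q\<^sup>2"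
        by (simp add: algebra_simps power2_eq_square)
      then show ?thesis
        by (simp add: s_squared[symmetric] algebra_simps)
    qed
    have eps: "(x - mx z)\<^sup>2 / sx\<^sup>2 = p\<^sup>2"
      "(x - mx z) * (y - my z) / (sx * sy) = p * (\<rho> * p + s * q)"
      "(y - my z)\<^sup>2 / sy\<^sup>2 = (\<rho> * p + s * q)\<^sup>2"
      unfolding p_def q_def fields eps_x_eq[of x z y] eps_y_eq[of y z x]
      using sx_pos sy_pos by (simp_all add: power_mult_distrib)
    have "score_rho mx my sx sy fZ \<rho> w
        = \<rho> / s\<^sup>2 + p * (\<rho> * p + s * q) / s\<^sup>2 - \<rho> * (s\<^sup>2 * (p\<^sup>2 + q\<^sup>2)) / (s\<^sup>2)\<^sup>2"
      unfolding Q[symmetric]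
      unfolding score_rho_def ganm_density_def fields split_conv eps s_squared
      by (rule DERIV_imp_deriv[OF has_derivative_ln_binormal_density[OF sx_pos sy_pos rho_bounds
              \<open>fZ z > 0\<close>]])
    also have "\<dots> = efficient_score w + scale_score w"
      unfolding efficient_score_def scale_score_def p_def[symmetric] q_def[symmetric]
      using s_pos by (simp add: divide_simps) (simp add: algebra_simps eval_nat_numeral)
    finally show ?thesis
      using False by (simp add: fields)
  qed
qed

lemma AE_fZ_nonzero: "AE \<omega> in M. fZ (Z \<omega>) \<noteq> 0"
proof -
  have "AE z in distr M lborel Z. fZ z \<noteq> 0"
    unfolding distributed_distr_eq_density[OF distributed_Z] by (subst AE_density) auto
  then show ?thesis
    by (rule AE_distrD[OF distributed_measurable[OF distributed_Z]])
qed

lemma is_efficient_score_efficient_score: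
  "is_efficient_score M X Y Z mx my sx sy fZ \<rho> efficient_score"
  unfolding is_efficient_score_def
proof (rule is_orth_projection_orth_complI[OF measurable_W(4) _ efficient_score_in_orth_compl
      scale_score_in_tangent_space scale_score_in_hilbert_fns])
  have [measurable]: "efficient_score \<in> borel_measurable borel" "scale_score \<in> borel_measurable borel"
    using hilbert_fnsD(1)[OF efficient_score_in_hilbert_fns] hilbert_fnsD(1)[OF scale_score_in_hilbert_fns]
    by simp_all
  have [measurable]: "(\<lambda>w. fZ (snd (snd w))) \<in> borel_measurable (borel :: (real \<times> real \<times> 'z) measure)"
    unfolding borel_prod[symmetric] by measurable
  show "score_rho mx my sx sy fZ \<rho> \<in> borel_measurable borel"
    unfolding score_rho_eq[abs_def] by measurable
  show "AE \<omega> in M. score_rho mx my sx sy fZ \<rho> (W \<omega>) = efficient_score (W \<omega>) + scale_score (W \<omega>)"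
    using AE_fZ_nonzero by eventually_elim (simp add: score_rho_eq)
qed

lemma is_efficient_score_unique:
  assumes "is_efficient_score M X Y Z mx my sx sy fZ \<rho> S"
  shows "AE \<omega> in M. S (W \<omega>) = efficient_score (W \<omega>)"
  using assms is_efficient_score_efficient_score unfolding is_efficient_score_def
  by (intro is_orth_projection_unique[OF measurable_W(4)]) (auto simp: orth_compl_def)

text \<open>
  Efficient scores are determined up to null sets only, which leaves their second moment, hence the
  bound, well defined.
\<close>

lemma is_efficient_score_second_moment:
  assumes S: "is_efficient_score M X Y Z mx my sx sy fZ \<rho> S"
  shows "inverse (\<integral>\<omega>. (S (W \<omega>))\<^sup>2 \<partial>M) = (1 - \<rho>\<^sup>2)\<^sup>2"
proof -
  have "S \<in> hilbert_fns M W"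
    using S by (simp add: is_efficient_score_def is_orth_projection_def orth_compl_def)
  note [measurable] = hilbert_fnsD(2)[OF this measurable_W(4)]
    hilbert_fnsD(2)[OF efficient_score_in_hilbert_fns measurable_W(4)]
  have "(\<integral>\<omega>. (S (W \<omega>))\<^sup>2 \<partial>M) = (\<integral>\<omega>. (efficient_score (W \<omega>))\<^sup>2 \<partial>M)"
    using is_efficient_score_unique[OF S] by (intro integral_cong_AE) auto
  then show ?thesis
    using efficient_score_second_moment by (simp add: has_bochner_integral_iff)
qed

lemma efficient_score_eq:
  "efficient_score (x, y, z) = - (1 / (2 * (1 - \<rho>\<^sup>2)\<^sup>2)) *
     (\<rho> * ((x - mx z) / sx)\<^sup>2 - 2 * ((x - mx z) / sx) * ((y - my z) / sy) + \<rho> * ((y - my z) / sy)\<^sup>2)"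
proof -
  define p q where "p = U (x, y, z)" and "q = V (x, y, z)"
  have eps: "(x - mx z) / sx = p" "(y - my z) / sy = \<rho> * p + s * q"
    using sx_pos sy_pos by (simp_all add: p_def q_def eps_x_eq[of x z y] eps_y_eq[of y z x])
  have "\<rho> * p\<^sup>2 - 2 * p * (\<rho> * p + s * q) + \<rho> * (\<rho> * p + s * q)\<^sup>2
      = - ((1 - \<rho>\<^sup>2) * (\<rho> * p\<^sup>2 + 2 * s * (p * q)) - \<rho> * s\<^sup>2 * q\<^sup>2)"
    by (simp add: algebra_simps power2_eq_square)
  also have "\<dots> = - s\<^sup>2 * (\<rho> * (p\<^sup>2 - q\<^sup>2) + 2 * s * (p * q))"
    unfolding s_squared[symmetric] by (simp add: algebra_simps)
  finally show ?thesis
    unfolding eps efficient_score_def p_def[symmetric] q_def[symmetric] s_squared[symmetric]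
    using s_pos by (simp add: power2_eq_square)
qed

end

theorem proposition3:
  fixes M :: "'w measure"
    and X Y :: "'w \<Rightarrow> real"
    and Z :: "'w \<Rightarrow> real ^ 'd"
    and mx my fZ :: "real ^ 'd \<Rightarrow> real"
    and sx sy \<rho> :: real
    and S_eff \<phi>_eff :: "real \<times> real \<times> (real ^ 'd) \<Rightarrow> real"
  assumes "prob_space M"
    and "sx > 0" and "sy > 0" and "- 1 < \<rho>" and "\<rho> < 1"
    and "mx \<in> borel_measurable borel" and "my \<in> borel_measurable borel"
    and "\<And>z. fZ z \<ge> 0"
    and "distributed M lborel Z (\<lambda>z. ennreal (fZ z))"
    and "distributed M lborel (\<lambda>\<omega>. (X \<omega>, Y \<omega>, Z \<omega>))
           (\<lambda>w. ennreal (ganm_density mx my sx sy fZ \<rho> w))"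
  defines "S_eff \<equiv> (\<lambda>(x, y, z).
             - (1 / (2 * (1 - \<rho>\<^sup>2)\<^sup>2)) *
             (\<rho> * ((x - mx z) / sx)\<^sup>2 - 2 * ((x - mx z) / sx) * ((y - my z) / sy)
              + \<rho> * ((y - my z) / sy)\<^sup>2))"
    and "\<phi>_eff \<equiv> (\<lambda>(x, y, z).
             - (1 / 2) *
             (\<rho> * ((x - mx z) / sx)\<^sup>2 - 2 * ((x - mx z) / sx) * ((y - my z) / sy)
              + \<rho> * ((y - my z) / sy)\<^sup>2))"
  shows "is_efficient_score M X Y Z mx my sx sy fZ \<rho> S_eff \<and>
         (\<forall>S. is_efficient_score M X Y Z mx my sx sy fZ \<rho> S \<longrightarrow>
            (AE \<omega> in M. S (X \<omega>, Y \<omega>, Z \<omega>) = S_eff (X \<omega>, Y \<omega>, Z \<omega>))) \<and>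
         (\<forall>b. is_efficiency_bound M X Y Z mx my sx sy fZ \<rho> b \<longleftrightarrow> b = (1 - \<rho>\<^sup>2)\<^sup>2) \<and>
         is_efficient_influence_function M X Y Z mx my sx sy fZ \<rho> \<phi>_eff \<and>
         (\<forall>\<phi>. is_efficient_influence_function M X Y Z mx my sx sy fZ \<rho> \<phi> \<longrightarrow>
            (AE \<omega> in M. \<phi> (X \<omega>, Y \<omega>, Z \<omega>) = \<phi>_eff (X \<omega>, Y \<omega>, Z \<omega>)))"
proof -
  interpret gaussian_anm M X Y Z mx my fZ sx sy \<rho>
    using assms(1-10) by (simp add: gaussian_anm_def gaussian_anm_axioms_def)
  have S: "S_eff = efficient_score"
    unfolding S_eff_def by (auto simp: fun_eq_iff efficient_score_eq)
  have \<phi>: "\<phi>_eff = (\<lambda>w. (1 - \<rho>\<^sup>2)\<^sup>2 * S_eff w)"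
    using s_pos unfolding \<phi>_eff_def S_eff_def s_squared[symmetric] by (auto simp: fun_eq_iff)
  show ?thesis
    using is_efficient_score_efficient_score is_efficient_score_unique is_efficient_score_second_moment
    unfolding is_efficiency_bound_def is_efficient_influence_function_def \<phi> S
    by auto
qed

end
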